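(* Let $f,g\in C(\mathbb{R})$, the constants $k_0,k_2,k^*,d$, and the sequences $\{\mu_j\}_{j\in\mathbb{N}},\{\nu_j\}_{j\in\mathbb{N}}$ of positive numbers converging to zero be as constructed in the context. For any $\lambda>0$, let $(u_\lambda,v_\lambda)\in\mathbb{R}^2$ denote the unique solution of the system $$\lambda u+f(u-v)=0,\qquad \lambda v+g(v-u)=0.$$ Then $$\lim_{j\to\infty}u_{\mu_j}=\frac{k_0d}{k_2}\quad\text{and}\quad \lim_{j\to\infty}u_{\nu_j}=\frac{k_0d}{k^*}.$$ In particular, $$\liminf_{\lambda\to0}u_\lambda\le\frac{k_0d}{k_2}<\frac{k_0d}{k^*}\le\limsup_{\lambda\to0}u_\lambda.$$
   Context: $\mathbb{N}=\{1,2,3,\dots\}$; limits in $\lambda$ are taken along $\lambda>0$. Construction. Fix $0<k_1<k_2$ and choose $k^*$ with $\frac12(k_1+k_2)<k^*<k_2$. Let $(x^*,y^* )$ be the intersection point of the lines $y=k^*x$ and $y=-\frac12k_2+k_1(x+\frac12)$; it satisfies $-1<x^*<-\frac12$. Set $k^+=\frac{y^*+k_2}{x^*+1}$ (so $k^+>k_2$). Define $$\psi(x)=\begin{cases}k_2x & \text{for } x\in(-\infty,-1]\cup[-\frac12,\infty),\\ \min\{-k_2+k^+(x+1),\,-\frac12k_2+k_1(x+\frac12)\} & \text{for } x\in(-1,-\frac12).\end{cases}$$ For $j\in\mathbb{N}$ set $\psi_j(x)=2^{-j}\psi(2^jx)$, and set $\eta(x)=\max_{j\in\mathbb{N}}\psi_j(x)$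 for $x\in\mathbb{R}$. Fix $d\ge1$ and define $h(x)=\eta(x-d)$. Fix $k_0\in(0,k_1)$ and define $f(x)=k_0(x-d)$ and $g(x)=f(-x)-h(-x)$ for $x\in\mathbb{R}$. (These $f,g$ are continuous and increasing, and for each $\lambda>0$ the system in the claim has a unique solution.) The sequences are, for $j\in\mathbb{N}$, $$\mu_j=\frac{k_22^{-j}}{d-2^{-j}},\qquad \nu_j=\frac{2^{-j}|y^*|}{d-2^{-j}|x^*|}.$$ *)

theory Defs
  imports "HOL-Analysis.Analysis"
begin

definition kplus :: "real \<Rightarrow> real \<Rightarrow> real \<Rightarrow> real" where
  "kplus k2 xs ys = (ys + k2) / (xs + 1)"

definition psi :: "real \<Rightarrow> real \<Rightarrow> real \<Rightarrow> real \<Rightarrow> real" where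
  "psi k1 k2 kp x =
     (if x \<in> {..-1} \<union> {-1/2..} then k2 * x
      else min (- k2 + kp * (x + 1)) (- (1/2) * k2 + k1 * (x + 1/2)))"

definition psi_scaled :: "real \<Rightarrow> real \<Rightarrow> real \<Rightarrow> nat \<Rightarrow> real \<Rightarrow> real" where
  "psi_scaled k1 k2 kp j x = 1 / 2 ^ j * psi k1 k2 kp (2 ^ j * x)"

text \<open>The maximum is over infinitely many indices, but it takes at most two values at each point
  (\<open>finite_psi_scaled\<close> below), so \<^const>\<open>Max\<close> is a genuine maximum for all parameters.\<close>

definition eta :: "real \<Rightarrow> real \<Rightarrow> real \<Rightarrow> real \<Rightarrow> real" where
  "eta k1 k2 kp x = Max ((\<lambda>j. psi_scaled k1 k2 kp j x) ` {1..})"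

definition h_fun :: "real \<Rightarrow> real \<Rightarrow> real \<Rightarrow> real \<Rightarrow> real \<Rightarrow> real" where
  "h_fun k1 k2 kp d x = eta k1 k2 kp (x - d)"

definition f_fun :: "real \<Rightarrow> real \<Rightarrow> real \<Rightarrow> real" where
  "f_fun k0 d x = k0 * (x - d)"

definition g_fun :: "real \<Rightarrow> real \<Rightarrow> real \<Rightarrow> real \<Rightarrow> real \<Rightarrow> real \<Rightarrow> real" where
  "g_fun k0 k1 k2 kp d x = f_fun k0 d (- x) - h_fun k1 k2 kp d (- x)"

text \<open>The sequences are only meaningful for \<open>j \<ge> 1\<close> (for \<open>d = 1\<close> the denominator of \<open>mu\<close> vanishes
  at \<open>j = 0\<close>).\<close>

definition mu :: "real \<Rightarrow> real \<Rightarrow> nat \<Rightarrow> real" where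
  "mu k2 d j = (k2 * (1 / 2 ^ j)) / (d - 1 / 2 ^ j)"

definition nu :: "real \<Rightarrow> real \<Rightarrow> real \<Rightarrow> nat \<Rightarrow> real" where
  "nu xs ys d j = (1 / 2 ^ j * \<bar>ys\<bar>) / (d - 1 / 2 ^ j * \<bar>xs\<bar>)"

lemma finite_psi_scaled: "finite ((\<lambda>j. psi_scaled k1 k2 kp j x) ` {1..})"
proof (cases "\<exists>j. 2 ^ j * x \<in> {-1<..<-1/2}")
  case False
  have "psi_scaled k1 k2 kp j x = k2 * x" for j
  proof -
    have "2 ^ j * x \<in> {..-1} \<union> {-1/2..}" using False by (auto simp: not_less not_le)
    then show ?thesis by (simp add: psi_scaled_def psi_def)
  qed
  then have "(\<lambda>j. psi_scaled k1 k2 kp j x) ` {1..} \<subseteq> {k2 * x}" by auto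
  then show ?thesis by (rule finite_subset) simp
next
  case True
  then obtain i where i: "2 ^ i * x > -1" "2 ^ i * x < -1/2" by auto
  have xneg: "x < 0" using i(2) by (smt (verit) divide_minus_left mult_nonneg_nonneg zero_le_power half_gt_zero)
  have "psi_scaled k1 k2 kp j x = k2 * x" if "j \<noteq> i" for j
  proof -
    have "2 ^ j * x \<le> -1 \<or> 2 ^ j * x \<ge> -1/2"
    proof (cases "j < i")
      case True
      have "(2::real) ^ Suc j \<le> 2 ^ i" using True by (intro power_increasing) auto
      then have "2 ^ Suc j * x \<ge> 2 ^ i * x" using xneg by (intro mult_right_mono_neg) auto
      then show ?thesis using i by simp
    next
      case False
      then have "(2::real) ^ Suc i \<le> 2 ^ j" using that by (intro power_increasing) auto
      then have "2 ^ j * x \<le> 2 ^ Suc i * x" using xneg by (intro mult_right_mono_neg) auto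
      then show ?thesis using i by simp
    qed
    then show ?thesis by (simp add: psi_scaled_def psi_def)
  qed
  then have "(\<lambda>j. psi_scaled k1 k2 kp j x) ` {1..} \<subseteq> {k2 * x, psi_scaled k1 k2 kp i x}"
    by (metis image_subsetI insertCI)
  then show ?thesis by (rule finite_subset) simp
qed

lemma star_bounds:
  assumes "0 < k1" "k1 < k2" "1/2 * (k1 + k2) < ks" "ks < k2"
    and "ys = ks * xs" "ys = - (1/2) * k2 + k1 * (xs + 1/2)"
  shows "- 1 < xs" "xs < - 1/2" "k2 < kplus k2 xs ys"
proof -
  have e: "(ks - k1) * xs = (k1 - k2) / 2" using assms(5,6) by (simp add: field_simps)
  have p: "ks - k1 > 0" using assms by simp
  have x: "xs = (k1 - k2) / (2 * (ks - k1))" using e p by (simp add: field_simps)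
  show 1: "- 1 < xs" using assms p unfolding x by (simp add: field_simps)
  show 2: "xs < - 1/2" using assms p unfolding x by (simp add: field_simps)
  have "k2 * xs < ks * xs" using assms(4) 2 by (intro mult_strict_right_mono_neg) auto
  then show "k2 < kplus k2 xs ys" using 1 assms(5) by (simp add: kplus_def field_simps)
qed

lemma psi_eq:
  assumes "k1 < k2" "k2 < kp"
  shows "psi k1 k2 kp x = max (k2 * x) (min (- k2 + kp * (x + 1)) (- (1/2) * k2 + k1 * (x + 1/2)))"
proof -
  have a: "k2 * x - (- k2 + kp * (x + 1)) = (k2 - kp) * (x + 1)"
    and b: "k2 * x - (- (1/2) * k2 + k1 * (x + 1/2)) = (k2 - k1) * (x + 1/2)"
    by (simp_all add: field_simps)
  have "x \<le> -1 \<Longrightarrow> (k2 - kp) * (x + 1) \<ge> 0" "x \<ge> -1/2 \<Longrightarrow> (k2 - k1) * (x + 1/2) \<ge> 0"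
    "x > -1 \<Longrightarrow> (k2 - kp) * (x + 1) \<le> 0" "x < -1/2 \<Longrightarrow> (k2 - k1) * (x + 1/2) \<le> 0"
    using assms by (simp_all add: mult_nonpos_nonpos mult_nonpos_nonneg mult_nonneg_nonpos)
  then show ?thesis using a b unfolding psi_def by (auto simp: max_def min_def)
qed

lemma psi_slope:
  assumes "k1 < k2" "k2 < kp" "x \<le> y"
  shows "k1 * (y - x) \<le> psi k1 k2 kp y - psi k1 k2 kp x"
    and "psi k1 k2 kp y - psi k1 k2 kp x \<le> kp * (y - x)"
proof -
  have "k1 * (y - x) \<le> k2 * (y - x)" "k2 * (y - x) \<le> kp * (y - x)"
    using assms by (auto intro: mult_right_mono)
  moreover have "k2 * y = k2 * x + k2 * (y - x)" "kp * (y + 1) = kp * (x + 1) + kp * (y - x)"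
    "k1 * (y + 1/2) = k1 * (x + 1/2) + k1 * (y - x)" by (simp_all add: field_simps)
  ultimately show "k1 * (y - x) \<le> psi k1 k2 kp y - psi k1 k2 kp x"
    "psi k1 k2 kp y - psi k1 k2 kp x \<le> kp * (y - x)"
    unfolding psi_eq[OF assms(1,2)] by linarith+
qed

lemma psi_scaled_slope:
  assumes "k1 < k2" "k2 < kp" "x \<le> y"
  shows "k1 * (y - x) \<le> psi_scaled k1 k2 kp j y - psi_scaled k1 k2 kp j x"
    and "psi_scaled k1 k2 kp j y - psi_scaled k1 k2 kp j x \<le> kp * (y - x)"
proof -
  have "2 ^ j * x \<le> 2 ^ j * y" using assms(3) by simp
  from psi_slope[OF assms(1,2) this]
  show "k1 * (y - x) \<le> psi_scaled k1 k2 kp j y - psi_scaled k1 k2 kp j x"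
    "psi_scaled k1 k2 kp j y - psi_scaled k1 k2 kp j x \<le> kp * (y - x)"
    by (simp_all add: psi_scaled_def field_simps)
qed

lemma eta_ge: "1 \<le> j \<Longrightarrow> psi_scaled k1 k2 kp j x \<le> eta k1 k2 kp x"
  unfolding eta_def by (rule Max_ge[OF finite_psi_scaled]) auto

lemma eta_attained: obtains j where "1 \<le> j" "eta k1 k2 kp x = psi_scaled k1 k2 kp j x"
proof -
  have "eta k1 k2 kp x \<in> (\<lambda>j. psi_scaled k1 k2 kp j x) ` {1..}"
    unfolding eta_def by (rule Max_in[OF finite_psi_scaled]) auto
  then show ?thesis using that by auto
qed

lemma eta_slope:
  assumes "k1 < k2" "k2 < kp" "x \<le> y"
  shows "k1 * (y - x) \<le> eta k1 k2 kp y - eta k1 k2 kp x"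
    and "eta k1 k2 kp y - eta k1 k2 kp x \<le> kp * (y - x)"
proof -
  obtain i where i: "1 \<le> i" "eta k1 k2 kp x = psi_scaled k1 k2 kp i x" by (rule eta_attained)
  show "k1 * (y - x) \<le> eta k1 k2 kp y - eta k1 k2 kp x"
    using psi_scaled_slope(1)[OF assms, of i] eta_ge[OF i(1), of k1 k2 kp y] i(2) by linarith
  obtain j where j: "1 \<le> j" "eta k1 k2 kp y = psi_scaled k1 k2 kp j y" by (rule eta_attained)
  show "eta k1 k2 kp y - eta k1 k2 kp x \<le> kp * (y - x)"
    using psi_scaled_slope(2)[OF assms, of j] eta_ge[OF j(1), of k1 k2 kp x] j(2) by linarith
qed

lemma continuous_on_eta:
  assumes "0 < k1" "k1 < k2" "k2 < kp"
  shows "continuous_on UNIV (eta k1 k2 kp)"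
proof (rule lipschitz_on_continuous_on, rule lipschitz_onI)
  show "0 \<le> kp" using assms by simp
  have *: "\<bar>eta k1 k2 kp y - eta k1 k2 kp x\<bar> \<le> kp * \<bar>y - x\<bar>" if "x \<le> y" for x y
    using eta_slope[OF assms(2,3) that] that assms(1)
    by (smt (verit) mult_nonneg_nonneg)
  show "dist (eta k1 k2 kp x) (eta k1 k2 kp y) \<le> kp * dist x y" for x y
    using *[of x y] *[of y x] by (cases "x \<le> y") (auto simp: dist_real_def abs_minus_commute)
qed

lemma f_fun_props:
  assumes "0 < k0"
  shows "continuous_on UNIV (f_fun k0 d)" "strict_mono (f_fun k0 d)"
  using assms by (auto simp: f_fun_def intro!: continuous_intros strict_monoI)

lemma g_fun_props:
  assumes "k0 < k1" "0 < k1" "k1 < k2" "k2 < kp"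
  shows "continuous_on UNIV (g_fun k0 k1 k2 kp d)" "strict_mono (g_fun k0 k1 k2 kp d)"
proof -
  show "continuous_on UNIV (g_fun k0 k1 k2 kp d)"
    unfolding g_fun_def f_fun_def h_fun_def
    by (intro continuous_intros continuous_on_compose2[OF continuous_on_eta[OF assms(2-4)]]) auto
  show "strict_mono (g_fun k0 k1 k2 kp d)"
  proof (rule strict_monoI)
    fix x y :: real assume xy: "x < y"
    then have "- y - d \<le> - x - d" by simp
    from eta_slope(1)[OF assms(3,4) this]
    have "k1 * (y - x) \<le> eta k1 k2 kp (- x - d) - eta k1 k2 kp (- y - d)" by simp
    moreover have "k0 * (y - x) < k1 * (y - x)" using xy assms by simp
    ultimately show "g_fun k0 k1 k2 kp d x < g_fun k0 k1 k2 kp d y"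
      by (simp add: g_fun_def f_fun_def h_fun_def algebra_simps)
  qed
qed

lemma system_unique_solution:
  assumes "0 < k1" "k1 < k2" "k2 < kp" "0 < lam"
  shows "\<exists>!(u, v). lam * u + f_fun k0 d (u - v) = 0 \<and> lam * v + g_fun k0 k1 k2 kp d (v - u) = 0"
proof -
  define F where "F w = lam * w + eta k1 k2 kp (w - d)" for w
  have slope: "lam * (y - x) \<le> F y - F x" if "x \<le> y" for x y
  proof -
    have "0 \<le> k1 * (y - x)" using that assms by simp
    with eta_slope(1)[OF assms(2,3), of "x - d" "y - d"] that
    show ?thesis by (simp add: F_def algebra_simps)
  qed
  have cont: "continuous_on UNIV F" unfolding F_def
    by (intro continuous_intros continuous_on_compose2[OF continuous_on_eta[OF assms(1-3)]]) auto
  define M where "M = \<bar>F 0\<bar> / lam"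
  have M: "0 \<le> M" "lam * M = \<bar>F 0\<bar>" using assms by (auto simp: M_def)
  have "F (- M) \<le> 0" "0 \<le> F M" using slope[of "- M" 0] slope[of 0 M] M by auto
  then obtain w where w: "F w = 0"
    using IVT'[of F "- M" 0 M] M continuous_on_subset[OF cont] by auto
  have w_unique: "w' = w" if "F w' = 0" for w'
    using slope[of w w'] slope[of w' w] w that assms(4)
    by (cases "w \<le> w'") (auto simp: mult_le_0_iff zero_le_mult_iff)
  have sys: "lam * u + f_fun k0 d (u - v) = 0 \<and> lam * v + g_fun k0 k1 k2 kp d (v - u) = 0
      \<longleftrightarrow> lam * u + f_fun k0 d (u - v) = 0 \<and> F (u - v) = 0" for u v
    by (auto simp: F_def g_fun_def h_fun_def algebra_simps)
  define u where "u = - f_fun k0 d w / lam"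
  have u: "lam * u' + f_fun k0 d w = 0 \<longleftrightarrow> u' = u" for u'
    using assms(4) by (auto simp: u_def field_simps)
  show ?thesis unfolding sys
  proof (rule ex1I[of _ "(u, u - w)"])
    show "case (u, u - w) of (u, v) \<Rightarrow> lam * u + f_fun k0 d (u - v) = 0 \<and> F (u - v) = 0"
      using u w by simp
  next
    fix p assume "case p of (u, v) \<Rightarrow> lam * u + f_fun k0 d (u - v) = 0 \<and> F (u - v) = 0"
    then obtain a b where p: "p = (a, b)" "lam * a + f_fun k0 d (a - b) = 0" "F (a - b) = 0"
      by (cases p) auto
    have "a - b = w" using w_unique p(3) .
    then have "a = u" using p(2) u by simp
    then show "p = (u, u - w)" using p(1) \<open>a - b = w\<close> by auto
  qed
qed

lemma mu_props:
  assumes "0 < k2" "1 \<le> d"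
  shows "1 \<le> j \<Longrightarrow> 0 < mu k2 d j" "mu k2 d \<longlonglongrightarrow> 0"
proof -
  have lim: "(\<lambda>j. 1 / 2 ^ j :: real) \<longlonglongrightarrow> 0"
    using LIMSEQ_realpow_zero[of "1/2"] by (simp add: power_divide)
  have "(\<lambda>j. (k2 * (1 / 2 ^ j)) / (d - 1 / 2 ^ j)) \<longlonglongrightarrow> (k2 * 0) / (d - 0)"
    by (intro tendsto_intros lim) (use assms in auto)
  then show "mu k2 d \<longlonglongrightarrow> 0" by (simp add: mu_def[abs_def])
  assume "1 \<le> j"
  then have "(1::real) / 2 ^ j < 1" by simp
  then have "0 < d - 1 / 2 ^ j" using assms by linarith
  then show "0 < mu k2 d j" unfolding mu_def
    by (intro divide_pos_pos mult_pos_pos) (use assms in auto)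
qed

lemma nu_props:
  assumes "- 1 < xs" "xs < 0" "ys < 0" "1 \<le> d"
  shows "1 \<le> j \<Longrightarrow> 0 < nu xs ys d j" "nu xs ys d \<longlonglongrightarrow> 0"
proof -
  have lim: "(\<lambda>j. 1 / 2 ^ j :: real) \<longlonglongrightarrow> 0"
    using LIMSEQ_realpow_zero[of "1/2"] by (simp add: power_divide)
  have "(\<lambda>j. (1 / 2 ^ j * \<bar>ys\<bar>) / (d - 1 / 2 ^ j * \<bar>xs\<bar>)) \<longlonglongrightarrow> (0 * \<bar>ys\<bar>) / (d - 0 * \<bar>xs\<bar>)"
    by (intro tendsto_intros lim) (use assms in auto)
  then show "nu xs ys d \<longlonglongrightarrow> 0" by (simp add: nu_def[abs_def])
  have "1 / 2 ^ j * \<bar>xs\<bar> \<le> 1 * \<bar>xs\<bar>" by (intro mult_right_mono) auto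
  then have "0 < d - 1 / 2 ^ j * \<bar>xs\<bar>" using assms by linarith
  then show "0 < nu xs ys d j" unfolding nu_def
    by (intro divide_pos_pos mult_pos_pos) (use assms in auto)
qed

end

theory Submission
  imports Defs
begin

text \<open>
  Write \<open>w = u - v\<close> and \<open>s = w - d\<close>. Subtracting the two equations eliminates \<open>f\<close> and leaves the
  scalar equation \<open>\<lambda> (s + d) + \<eta> s = 0\<close>, whose left-hand side is strictly increasing in \<open>s\<close>, so that
  any guessed root is the root; the first equation then gives \<open>u = - k0 s / \<lambda>\<close>. If \<open>c = \<eta> s / s\<close> is the
  slope of the chord of \<open>\<eta>\<close> from the origin to \<open>s\<close>, then \<open>\<lambda> = - c s / (s + d)\<close> and therefore
  \<open>u = k0 (s + d) / c\<close>. Hence \<open>u\<close> tends to \<open>k0 d / c\<close> along any sequence of roots \<open>s\<close> that tends to \<open>0\<close>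
  with constant chord slope \<open>c\<close> (\<open>solution_of_chord\<close>).

  The function \<open>\<eta>\<close> is built to have two different chord slopes at every scale. Near the point
  \<open>2 ^ - j * x\<close> with \<open>-1 < x < -1/2\<close> only the \<open>j\<close>-th rescaled copy of \<open>\<psi>\<close> leaves the line of slope
  \<open>k2\<close>, because the intervals on which the different copies do so are disjoint. At the dyadic points
  \<open>- (2 ^ - j)\<close> all copies lie on that line, so the slope is \<open>k2\<close> (\<open>eta_dyadic\<close>); at \<open>2 ^ - j * x\<^sup>*\<close> the
  \<open>j\<close>-th copy reaches its corner, which lies on the line of slope \<open>k\<^sup>*\<close> (\<open>eta_corner\<close>). The sequences
  \<open>\<mu>\<close> and \<open>\<nu>\<close> are exactly the values of \<open>\<lambda>\<close> whose roots are these points. Since \<open>k\<^sup>* < k2\<close>, the limit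
  along \<open>\<mu>\<close>, which bounds the lower limit of \<open>u\<close> from above, is smaller than the limit along \<open>\<nu>\<close>,
  which bounds the upper limit from below.
\<close>

section \<open>Values of the envelope at the dyadic points and at the corners\<close>

lemma psi_scaled_on_line:
  assumes "2 ^ i * x \<le> - 1 \<or> - 1/2 \<le> 2 ^ i * x"
  shows "psi_scaled k1 k2 kp i x = k2 * x"
  using assms by (auto simp: psi_scaled_def psi_def)

text \<open>
  Passing to a finer scale at least doubles the argument, passing to a coarser one at least halves it,
  so every copy other than the \<open>j\<close>-th sees the point outside \<open>(-1, -1/2)\<close>.
\<close>

lemma psi_scaled_other_scale:
  assumes "i \<noteq> j" "- 1 \<le> x" "x \<le> - 1/2"
  shows "psi_scaled k1 k2 kp i (x / 2 ^ j) = k2 * (x / 2 ^ j)"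
proof (rule psi_scaled_on_line)
  show "2 ^ i * (x / 2 ^ j) \<le> - 1 \<or> - 1/2 \<le> 2 ^ i * (x / 2 ^ j)"
  proof (cases "i < j")
    case True
    then have "(2::real) ^ Suc i \<le> 2 ^ j" by (intro power_increasing) auto
    then have "2 ^ i / 2 ^ j \<le> (1/2::real)" by (simp add: field_simps)
    then have "(2 ^ i / 2 ^ j) * (- x) \<le> (1/2) * (- x)"
      using assms by (intro mult_right_mono) auto
    then have "- 1/2 \<le> (2 ^ i / 2 ^ j) * x" using assms by linarith
    then show ?thesis by simp
  next
    case False
    then have "(2::real) ^ Suc j \<le> 2 ^ i" using assms(1) by (intro power_increasing) auto
    then have "2 \<le> (2 ^ i / 2 ^ j :: real)" by (simp add: field_simps)
    then have "2 * (- x) \<le> (2 ^ i / 2 ^ j) * (- x)"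
      using assms by (intro mult_right_mono) auto
    then have "(2 ^ i / 2 ^ j) * x \<le> - 1" using assms by linarith
    then show ?thesis by simp
  qed
qed

text \<open>
  The \<open>j\<close>-th copy is the maximal one as soon as it does not fall below the line of slope \<open>k2\<close>,
  on which all the others lie.
\<close>

lemma eta_at_scale:
  assumes "1 \<le> j" "- 1 \<le> x" "x \<le> - 1/2" "k2 * x \<le> psi k1 k2 kp x"
  shows "eta k1 k2 kp (x / 2 ^ j) = psi k1 k2 kp x / 2 ^ j"
proof -
  have j: "psi_scaled k1 k2 kp j (x / 2 ^ j) = psi k1 k2 kp x / 2 ^ j"
    by (simp add: psi_scaled_def)
  obtain i where i: "eta k1 k2 kp (x / 2 ^ j) = psi_scaled k1 k2 kp i (x / 2 ^ j)"
    by (rule eta_attained)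
  have "k2 * (x / 2 ^ j) \<le> psi k1 k2 kp x / 2 ^ j"
    using divide_right_mono[OF assms(4), of "2 ^ j"] by simp
  then have "eta k1 k2 kp (x / 2 ^ j) \<le> psi k1 k2 kp x / 2 ^ j"
    using i j psi_scaled_other_scale[OF _ assms(2,3), of i j]
    by (cases "i = j") auto
  with eta_ge[OF assms(1), of k1 k2 kp "x / 2 ^ j"] j show ?thesis by simp
qed

lemma eta_dyadic:
  assumes "1 \<le> j"
  shows "eta k1 k2 kp (- 1 / 2 ^ j) = k2 * (- 1 / 2 ^ j)"
  using eta_at_scale[OF assms, of "- 1" k2 k1 kp] by (simp add: psi_def)

text \<open>
  The slope \<open>kplus\<close> is chosen so that the two lines in the minimum cross at the corner
  \<open>(xs, ks * xs)\<close>.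
\<close>

lemma eta_corner:
  assumes "1 \<le> j" "- 1 < xs" "xs < - 1/2" "ks \<le> k2"
    and "ks * xs = - (1/2) * k2 + k1 * (xs + 1/2)"
  shows "eta k1 k2 (kplus k2 xs (ks * xs)) (xs / 2 ^ j) = ks * (xs / 2 ^ j)"
proof -
  have "kplus k2 xs (ks * xs) * (xs + 1) = ks * xs + k2"
    using assms(2) by (simp add: kplus_def)
  then have psi: "psi k1 k2 (kplus k2 xs (ks * xs)) xs = ks * xs"
    using assms(2,3,5) by (simp add: psi_def)
  have "k2 * xs \<le> ks * xs" using assms(3,4) by (intro mult_right_mono_neg) auto
  with eta_at_scale[OF assms(1), of xs k2 k1 "kplus k2 xs (ks * xs)"] psi assms(2,3)
  show ?thesis by simp
qed

section \<open>Solving the system from a known chord slope\<close>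

text \<open>
  The system reduces to a scalar equation with a strictly increasing left-hand side, which has \<open>s\<close> as
  a root precisely for this value of \<open>lam\<close>.
\<close>

lemma solution_of_chord:
  assumes "0 < k1" "k1 < k2" "k2 < kp" "0 < c" "s < 0" "0 < s + d"
    and "eta k1 k2 kp s = c * s" "lam = - (c * s) / (s + d)"
    and "lam * u + f_fun k0 d (u - v) = 0"
    and "lam * v + g_fun k0 k1 k2 kp d (v - u) = 0"
  shows "u = k0 * (s + d) / c"
proof -
  define t where "t = u - v - d"
  have u: "lam * u + k0 * t = 0" using assms(9) by (simp add: f_fun_def t_def)
  have "lam * v + k0 * t - eta k1 k2 kp t = 0"
    using assms(10) by (simp add: g_fun_def f_fun_def h_fun_def t_def)
  with u have root_t: "lam * (t + d) + eta k1 k2 kp t = 0"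
    by (simp add: t_def algebra_simps)
  have lam: "lam * (s + d) = - (c * s)" using assms(6,8) by simp
  then have root_s: "lam * (s + d) + eta k1 k2 kp s = 0" using assms(7) by simp
  have "0 < lam" unfolding assms(8)
    using assms(4-6) by (intro divide_pos_pos) (auto simp: mult_pos_neg)
  have increasing: "lam * (b + d) + eta k1 k2 kp b > lam * (a + d) + eta k1 k2 kp a"
    if "a < b" for a b
  proof -
    have "0 < lam * (b - a)" "0 < k1 * (b - a)" using that \<open>0 < lam\<close> assms(1) by auto
    with eta_slope(1)[OF assms(2,3), of a b] that show ?thesis by (simp add: algebra_simps)
  qed
  have "t = s"
    using increasing[of s t] increasing[of t s] root_s root_t by (cases s t rule: linorder_cases) auto
  then have "lam * u = - (k0 * s)" using u by simp
  then have "lam * (s + d) * u = - (k0 * s) * (s + d)" by (metis mult.assoc mult.commute)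
  then have "(c * s) * u = (k0 * s) * (s + d)" using lam by simp
  then have "s * (c * u) = s * (k0 * (s + d))" by (simp add: algebra_simps)
  then have "c * u = k0 * (s + d)" using assms(5) by simp
  then show ?thesis using assms(4) by (simp add: field_simps)
qed

section \<open>Extreme limits along a filter\<close>

text \<open>
  A bound that holds on an \<open>F\<close>-large set eventually holds along \<open>x\<close>, hence also for the limit.
\<close>

lemma Liminf_le_limit_le_Limsup:
  fixes f :: "'a \<Rightarrow> ereal"
  assumes "filterlim x F sequentially" "(\<lambda>n. f (x n)) \<longlonglongrightarrow> L"
  shows "Liminf F f \<le> L" "L \<le> Limsup F f"
proof -
  have along: "eventually (\<lambda>n. P (x n)) sequentially" if "eventually P F" for P
    using assms(1) that by (simp add: filterlim_iff)
  show "Liminf F f \<le> L"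
  proof (rule Liminf_least)
    fix P assume "eventually P F"
    from along[OF this] show "(INF y\<in>Collect P. f y) \<le> L"
      by (intro tendsto_lowerbound[OF assms(2)]) (auto elim!: eventually_mono intro: INF_lower)
  qed
  show "L \<le> Limsup F f"
  proof (rule Limsup_greatest)
    fix P assume "eventually P F"
    from along[OF this] show "L \<le> (SUP y\<in>Collect P. f y)"
      by (intro tendsto_upperbound[OF assms(2)]) (auto elim!: eventually_mono intro: SUP_upper)
  qed
qed

section \<open>Two different limits along null sequences\<close>

theorem theorem7:
  fixes k0 k1 k2 kstar xstar ystar kp d :: real and u v :: "real \<Rightarrow> real"
  assumes "0 < k1" and "k1 < k2"
    and "1/2 * (k1 + k2) < kstar" and "kstar < k2"
    and "ystar = kstar * xstar"
    and "ystar = - (1/2) * k2 + k1 * (xstar + 1/2)"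
    and "kp = kplus k2 xstar ystar"
    and "1 \<le> d"
    and "0 < k0" and "k0 < k1"
    and "\<And>lam. 0 < lam \<Longrightarrow>
           lam * u lam + f_fun k0 d (u lam - v lam) = 0 \<and>
           lam * v lam + g_fun k0 k1 k2 kp d (v lam - u lam) = 0"
  shows "(\<lambda>j. u (mu k2 d j)) \<longlonglongrightarrow> k0 * d / k2
    \<and> (\<lambda>j. u (nu xstar ystar d j)) \<longlonglongrightarrow> k0 * d / kstar
    \<and> Liminf (at_right 0) (\<lambda>lam. ereal (u lam)) \<le> ereal (k0 * d / k2)
    \<and> k0 * d / k2 < k0 * d / kstar
    \<and> ereal (k0 * d / kstar) \<le> Limsup (at_right 0) (\<lambda>lam. ereal (u lam))"
proof -
  note bounds = star_bounds[OF assms(1-6)]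
  have pos: "0 < k2" "0 < kstar" "k2 < kp" "xstar < 0" "ystar < 0"
    using assms(1-7) bounds by (auto simp: mult_less_0_iff)

  (* Taken with x = - 1, c = k2 for mu and with x = xstar, c = kstar for nu. *)
  have limit: "(\<lambda>j. u (lam j)) \<longlonglongrightarrow> k0 * d / c"
    if lam: "\<And>j. 1 \<le> j \<Longrightarrow> 0 < lam j"
      and x: "- 1 \<le> x" "x < 0" and c: "0 < c"
      and chord: "\<And>j. 1 \<le> j \<Longrightarrow> eta k1 k2 kp (x / 2 ^ j) = c * (x / 2 ^ j)"
      and lam_eq: "\<And>j. lam j = - (c * (x / 2 ^ j)) / (x / 2 ^ j + d)"
    for lam :: "nat \<Rightarrow> real" and x c
  proof -
    have eq: "u (lam j) = k0 * (x / 2 ^ j + d) / c" if j: "1 \<le> j" for j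
    proof -
      have "(2::real) ^ 1 \<le> 2 ^ j" using j by (intro power_increasing) auto
      then have "- 1 < x / 2 ^ j" using x by (simp add: field_simps)
      then have "0 < x / 2 ^ j + d" using assms(8) by linarith
      then show ?thesis
        using solution_of_chord[OF assms(1,2) pos(3) c _ _ chord[OF j] lam_eq,
            of "u (lam j)" k0 "v (lam j)"]
          assms(11)[OF lam[OF j]] x(2) by (simp add: divide_neg_pos)
    qed
    have "(\<lambda>j. 1 / 2 ^ j :: real) \<longlonglongrightarrow> 0"
      using LIMSEQ_realpow_zero[of "1/2"] by (simp add: power_divide)
    then have "(\<lambda>j. k0 * (x * (1 / 2 ^ j) + d) / c) \<longlonglongrightarrow> k0 * (x * 0 + d) / c"
      using c by (intro tendsto_intros) auto
    then have "(\<lambda>j. k0 * (x / 2 ^ j + d) / c) \<longlonglongrightarrow> k0 * d / c" by simp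
    then show ?thesis
      by (rule Lim_transform_eventually)
        (use eq in \<open>auto intro!: eventually_sequentiallyI[of 1]\<close>)
  qed

  have mu_pos: "0 < mu k2 d j" if "1 \<le> j" for j using mu_props(1)[OF pos(1) assms(8) that] .
  have nu_pos: "0 < nu xstar ystar d j" if "1 \<le> j" for j
    using nu_props(1)[OF bounds(1) pos(4,5) assms(8) that] .
  have mu_lim: "(\<lambda>j. u (mu k2 d j)) \<longlonglongrightarrow> k0 * d / k2"
    using pos eta_dyadic by (intro limit[of "mu k2 d" "- 1"] mu_pos) (auto simp: mu_def)
  have nu_lim: "(\<lambda>j. u (nu xstar ystar d j)) \<longlonglongrightarrow> k0 * d / kstar"
  proof (rule limit[of "nu xstar ystar d" xstar])
    show "eta k1 k2 kp (xstar / 2 ^ j) = kstar * (xstar / 2 ^ j)" if "1 \<le> j" for j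
      using eta_corner[OF that bounds(1,2), of kstar k2 k1] assms(4-7) by simp
    show "nu xstar ystar d j = - (kstar * (xstar / 2 ^ j)) / (xstar / 2 ^ j + d)" for j
      using pos assms(5) by (simp add: nu_def add.commute)
  qed (use pos bounds nu_pos in auto)

  have "filterlim (mu k2 d) (at_right 0) sequentially"
    using mu_props(2)[OF pos(1) assms(8)] mu_pos
    by (auto intro!: tendsto_imp_filterlim_at_right eventually_sequentiallyI[of 1])
  then have "Liminf (at_right 0) (\<lambda>lam. ereal (u lam)) \<le> ereal (k0 * d / k2)"
    by (rule Liminf_le_limit_le_Limsup(1)) (use mu_lim in simp)
  moreover have "filterlim (nu xstar ystar d) (at_right 0) sequentially"
    using nu_props(2)[OF bounds(1) pos(4,5) assms(8)] nu_pos
    by (auto intro!: tendsto_imp_filterlim_at_right eventually_sequentiallyI[of 1])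
  then have "ereal (k0 * d / kstar) \<le> Limsup (at_right 0) (\<lambda>lam. ereal (u lam))"
    by (rule Liminf_le_limit_le_Limsup(2)) (use nu_lim in simp)
  moreover have "k0 * d / k2 < k0 * d / kstar"
    using assms(4,8,9) pos by (intro divide_strict_left_mono) auto
  ultimately show ?thesis using mu_lim nu_lim by simp
qed

end
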